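(* Let $\mu\in\mathbb{R}^n$, let $K$ be a closed convex subset of $\mathbb{R}^n$, let $u\in K$, and let $\mathcal{T}_{K,u}$ be the tangent cone of $K$ at $u$. Let $\sigma>0$, $\xi\sim\mathcal{N}(0,\sigma^2 I_{n\times n})$, $y=\mu+\xi$ and $\hat\mu=\hat\mu^{LS}(K)$. Then $$\mathbb{E}\left[\|\hat\mu-\mu\|^2\right]\le \|u-\mu\|^2+\frac{\sigma^2}{n}\,\delta(\mathcal{T}_{K,u}).$$ Furthermore, for all $x>0$, with probability at least $1-e^{-x}$, $$\|\hat\mu-\mu\|^2-\|u-\mu\|^2\le \frac{\sigma^2}{n}\left(\delta(\mathcal{T}_{K,u})^{1/2}+\sqrt{2x}\right)^2\le\frac{\sigma^2}{n}\left(2\,\delta(\mathcal{T}_{K,u})+4x\right).$$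
   Context: Scaled norm: $\|v\|^2=\frac1n\sum_{i=1}^n v_i^2$ for $v\in\mathbb{R}^n$; $|\cdot|_2$ is the Euclidean norm. The least squares estimator over a nonempty closed set $K$ is $\hat\mu^{LS}(K)\in\operatorname{argmin}_{v\in K}\|y-v\|^2$ (for $K$ closed convex, it is the projection $\Pi_K(y)$). Tangent cone: $\mathcal{T}_{K,u}=\mathrm{closure}\{t(v-u): t\ge0,\ v\in K\}$. Statistical dimension of a closed convex cone $L\subset\mathbb{R}^n$: $\delta(L)=\mathbb{E}\left[|\Pi_L(g)|_2^2\right]$, where $g\sim\mathcal{N}(0,I_{n\times n})$ and $\Pi_L$ is the Euclidean projection onto $L$. *)

theory Defs
  imports "HOL-Probability.Probability"
begin

definition scaled_norm :: "real ^ 'n \<Rightarrow> real" where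
  "scaled_norm v = sqrt (1 / real CARD('n) * (\<Sum>i\<in>UNIV. (v $ i)\<^sup>2))"

(* Minimisers over K need not exist or be unique for general K, so the estimator is a relation. *)
definition is_least_squares :: "(real ^ 'n) set \<Rightarrow> real ^ 'n \<Rightarrow> real ^ 'n \<Rightarrow> bool" where
  "is_least_squares K y m \<longleftrightarrow> is_arg_min (\<lambda>v. (scaled_norm (y - v))\<^sup>2) (\<lambda>v. v \<in> K) m"

definition tangent_cone :: "(real ^ 'n) set \<Rightarrow> real ^ 'n \<Rightarrow> (real ^ 'n) set" where
  "tangent_cone K u = closure {t *\<^sub>R (v - u) | t v. t \<ge> 0 \<and> v \<in> K}"

(* Lebesgue density of N(0, s^2 I); s is the standard deviation of each coordinate. *)
definition isotropic_normal_density :: "real \<Rightarrow> real ^ 'n \<Rightarrow> real" where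
  "isotropic_normal_density s x = (\<Prod>i\<in>UNIV. normal_density 0 s (x $ i))"

(* The integrand is dominated by the squared norm of g when L is a closed convex cone,
   so the Bochner integral is then a genuine (finite) expectation. *)
definition statistical_dimension :: "(real ^ 'n) set \<Rightarrow> real" where
  "statistical_dimension L =
     (\<integral>g. (norm (closest_point L g))\<^sup>2
        \<partial>(density lborel (\<lambda>x. ennreal (isotropic_normal_density 1 x))))"

end

theory Submission
  imports Defs
begin

text \<open>
  Let \<open>p\<close> be the projection onto the tangent cone. The variational inequality for the projection
  onto \<open>K\<close> bounds the excess risk, in Euclidean norm, by \<open>2 * (\<xi> \<bullet> d) - (norm d)\<^sup>2\<close> with
  \<open>d = \<mu>hat - u\<close> in the cone, and this is at most \<open>(norm (p \<xi>))\<^sup>2\<close>. Taking expectations gives the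
  first bound. The second one is Gaussian concentration, with the sharp constant, of the 1-Lipschitz
  function \<open>norm \<circ> p\<close>, whose mean is at most \<open>\<sigma> * sqrt \<delta>\<close>.

  Concentration follows from the Prekopa-Leindler inequality (Maurey, Bobkov-Ledoux). Let \<open>F\<close> be
  \<open>L\<close>-Lipschitz and let \<open>X\<close> be normal with standard deviation \<open>s\<close>. Applied with weights \<open>1\<close> and \<open>n\<close>
  to the density tilted by \<open>exp F\<close> and by \<open>exp (- F / n)\<close>, the inequality gives
  \<open>E exp (F X) * (E exp (- F X / n)) ^ n \<le> exp (L\<^sup>2 * s\<^sup>2 * (1 + 1 / n) / 2)\<close>. By Jensen the second
  factor is at least \<open>exp (- E F X)\<close>, and \<open>n\<close> tends to infinity.

  Prekopa-Leindler itself reduces, one coordinate at a time, to the real line, where it is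
  Brunn-Minkowski for superlevel sets integrated over the level.
\<close>

subsection \<open>The Prekopa-Leindler inequality\<close>

lemma emeasure_lebesgue_inner_compact:
  fixes S :: "'a::euclidean_space set"
  assumes [measurable]: "S \<in> sets lebesgue"
  shows "emeasure lebesgue S = (SUP K\<in>{K. compact K \<and> K \<subseteq> S}. emeasure lebesgue K)"
proof (rule antisym)
  let ?inner = "SUP K\<in>{K. compact K \<and> K \<subseteq> S}. emeasure lebesgue K"
  have bounded_part: "emeasure lebesgue (S \<inter> cball 0 (real n)) \<le> ?inner" for n
  proof (rule ennreal_le_epsilon)
    fix e :: real assume "e > 0"
    moreover have "S \<inter> cball 0 (real n) \<in> sets lebesgue"
      by (intro sets.Int assms fmeasurableD lmeasurable_cball)
    ultimately obtain T where T: "closed T" "T \<subseteq> S \<inter> cball 0 (real n)"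
      and diff: "S \<inter> cball 0 (real n) - T \<in> lmeasurable"
        "emeasure lebesgue (S \<inter> cball 0 (real n) - T) < ennreal e"
      using sets_lebesgue_inner_closed by blast
    have "compact T"
      using T bounded_subset[OF bounded_cball] by (auto simp: compact_eq_bounded_closed)
    have "emeasure lebesgue (S \<inter> cball 0 (real n)) =
        emeasure lebesgue (T \<union> (S \<inter> cball 0 (real n) - T))"
      using T(2) by (intro arg_cong[where f="emeasure lebesgue"]) auto
    also have "\<dots> \<le> emeasure lebesgue T + emeasure lebesgue (S \<inter> cball 0 (real n) - T)"
      using T(1) diff(1) by (intro emeasure_subadditive) auto
    also have "\<dots> \<le> ?inner + ennreal e"
      using \<open>compact T\<close> T(2) diff(2) by (intro add_mono SUP_upper) auto
    finally show "emeasure lebesgue (S \<inter> cball 0 (real n)) \<le> ?inner + ennreal e" .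
  qed
  have "(\<Union>n. S \<inter> cball 0 (real n)) = S"
    using real_arch_simple by fastforce
  moreover have "incseq (\<lambda>n. S \<inter> cball 0 (real n))"
    by (auto simp: incseq_def)
  ultimately have "emeasure lebesgue S = (SUP n. emeasure lebesgue (S \<inter> cball 0 (real n)))"
    by (subst SUP_emeasure_incseq) auto
  then show "emeasure lebesgue S \<le> ?inner"
    using bounded_part by (simp add: SUP_least)
qed (rule SUP_least, rule emeasure_mono, auto)

lemma emeasure_lebesgue_scale_le:
  fixes A B :: "real set"
  assumes "0 < r" "B \<in> sets lebesgue" "\<And>x. x \<in> A \<Longrightarrow> r * x + c \<in> B"
  shows "ennreal r * emeasure lebesgue A \<le> emeasure lebesgue B"
proof -
  have "ennreal r * emeasure lebesgue A = emeasure lebesgue ((\<lambda>x. r *\<^sub>R x + c) ` A)"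
    using emeasure_lebesgue_affine[of r c A] \<open>0 < r\<close> by simp
  also have "\<dots> \<le> emeasure lebesgue B"
    using assms(2,3) by (intro emeasure_mono) auto
  finally show ?thesis .
qed

lemma brunn_minkowski_real_compact:
  fixes A B C :: "real set"
  assumes "compact A" "A \<noteq> {}" "compact B" "B \<noteq> {}" and C [measurable]: "C \<in> sets lebesgue"
    and weights: "0 < r" "0 < s"
    and combination: "\<And>a b. a \<in> A \<Longrightarrow> b \<in> B \<Longrightarrow> r * a + s * b \<in> C"
  shows "ennreal r * emeasure lebesgue A + ennreal s * emeasure lebesgue B \<le> emeasure lebesgue C"
proof -
  obtain a where a_max: "a \<in> A" "\<And>x. x \<in> A \<Longrightarrow> x \<le> a"
    using compact_attains_sup[OF assms(1,2)] by blast
  obtain b where b_min: "b \<in> B" "\<And>y. y \<in> B \<Longrightarrow> b \<le> y"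
    using compact_attains_inf[OF assms(3,4)] by blast
  define z where "z = r * a + s * b"
  have left: "ennreal r * emeasure lebesgue A \<le> emeasure lebesgue (C \<inter> {..z})"
    using a_max b_min weights combination
    by (intro emeasure_lebesgue_scale_le[where c="s * b"]) (auto simp: z_def)
  have "ennreal s * emeasure lebesgue B \<le> emeasure lebesgue (C \<inter> {z<..} \<union> {z})"
  proof (rule emeasure_lebesgue_scale_le[where c="r * a"])
    fix y assume "y \<in> B"
    then have "r * a + s * y \<in> C" "z \<le> r * a + s * y"
      using a_max b_min weights combination by (auto simp: z_def)
    then show "s * y + r * a \<in> C \<inter> {z<..} \<union> {z}"
      by (auto simp: add.commute)
  qed (rule weights, intro sets.Un sets.Int C, simp_all)
  also have "\<dots> \<le> emeasure lebesgue (C \<inter> {z<..}) + emeasure lebesgue {z}"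
    by (rule emeasure_subadditive) auto
  finally have right: "ennreal s * emeasure lebesgue B \<le> emeasure lebesgue (C \<inter> {z<..})" by simp
  have "C = (C \<inter> {..z}) \<union> (C \<inter> {z<..})" by auto
  then have "emeasure lebesgue C = emeasure lebesgue (C \<inter> {..z}) + emeasure lebesgue (C \<inter> {z<..})"
    by (subst plus_emeasure) (auto simp flip: Int_Un_distrib)
  then show ?thesis using add_mono[OF left right] by simp
qed

lemma brunn_minkowski_real:
  fixes A B C :: "real set"
  assumes [measurable]: "A \<in> sets lebesgue" "B \<in> sets lebesgue" "C \<in> sets lebesgue"
    and "A \<noteq> {}" "B \<noteq> {}" and weights: "0 < r" "0 < s"
    and combination: "\<And>a b. a \<in> A \<Longrightarrow> b \<in> B \<Longrightarrow> r * a + s * b \<in> C"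
  shows "ennreal r * emeasure lebesgue A + ennreal s * emeasure lebesgue B \<le> emeasure lebesgue C"
proof -
  obtain a b where in_AB: "a \<in> A" "b \<in> B" using assms(4,5) by blast
  let ?compacts = "\<lambda>S. {K. compact K \<and> K \<subseteq> S}"
  have "?compacts S \<noteq> {}" for S by auto
  then have nonempty_compacts: "?compacts A \<noteq> {}" "?compacts B \<noteq> {}" by blast+
  have compact_case: "ennreal r * emeasure lebesgue K + ennreal s * emeasure lebesgue L
      \<le> emeasure lebesgue C" if "K \<in> ?compacts A" "L \<in> ?compacts B" for K L
  proof -
    have "compact (insert a K)" "compact (insert b L)"
      using that by (auto intro: compact_insert)
    then have "ennreal r * emeasure lebesgue K + ennreal s * emeasure lebesgue L
        \<le> ennreal r * emeasure lebesgue (insert a K) + ennreal s * emeasure lebesgue (insert b L)"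
      by (intro add_mono mult_left_mono emeasure_mono) (auto simp: compact_imp_closed)
    also have "\<dots> \<le> emeasure lebesgue C"
      using that in_AB weights combination \<open>compact (insert a K)\<close> \<open>compact (insert b L)\<close>
      by (intro brunn_minkowski_real_compact) auto
    finally show ?thesis .
  qed
  have "ennreal r * emeasure lebesgue A + ennreal s * emeasure lebesgue B =
      (SUP L\<in>?compacts B. SUP K\<in>?compacts A.
        ennreal r * emeasure lebesgue K + ennreal s * emeasure lebesgue L)"
    unfolding emeasure_lebesgue_inner_compact[OF assms(1)]
      emeasure_lebesgue_inner_compact[OF assms(2)]
      SUP_mult_left_ennreal
    by (simp only: ennreal_SUP_add_left[OF nonempty_compacts(1), symmetric]
        ennreal_SUP_add_right[OF nonempty_compacts(2)])
  then show ?thesis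
    using compact_case by (auto intro!: SUP_least)
qed

lemma emeasure_lborel_Ioi: "emeasure lborel {a::real<..} = \<infinity>"
proof -
  have "of_nat n \<le> emeasure lborel {a<..}" for n
  proof -
    have "emeasure lborel {a<..<a + real n} \<le> emeasure lborel {a<..}"
      by (intro emeasure_mono) auto
    then show ?thesis by (simp add: ennreal_of_nat_eq_real_of_nat)
  qed
  then have "(SUP n. of_nat n) \<le> emeasure lborel {a<..}"
    by (rule SUP_least)
  then show ?thesis
    by (simp add: ennreal_SUP_of_nat_eq_top top_unique)
qed

lemma (in sigma_finite_measure) nn_integral_eq_emeasure_superlevel:
  fixes f :: "'a \<Rightarrow> ennreal"
  assumes [measurable]: "f \<in> borel_measurable M"
  shows "(\<integral>\<^sup>+x. f x \<partial>M) =
    (\<integral>\<^sup>+t. indicator {0<..} t * emeasure M {x \<in> space M. ennreal t < f x} \<partial>lborel)"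
proof -
  interpret pair_sigma_finite lborel M ..
  have "y = (\<integral>\<^sup>+t. indicator {t. 0 < t \<and> ennreal t < y} t \<partial>lborel)" for y
  proof (cases y)
    case (real r)
    then have "{t. 0 < t \<and> ennreal t < y} = {0<..<r}"
      by (auto simp: ennreal_less_iff)
    then show ?thesis using real by simp
  next
    case top
    then have "{t. 0 < t \<and> ennreal t < y} = {0<..}" by auto
    then show ?thesis using top by (simp add: emeasure_lborel_Ioi)
  qed
  then have "(\<integral>\<^sup>+x. f x \<partial>M) =
      (\<integral>\<^sup>+x. \<integral>\<^sup>+t. indicator {t. 0 < t \<and> ennreal t < f x} t \<partial>lborel \<partial>M)"
    by simp
  also have "\<dots> = (\<integral>\<^sup>+t. \<integral>\<^sup>+x. indicator {t. 0 < t \<and> ennreal t < f x} t \<partial>M \<partial>lborel)"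
    by (rule Fubini') measurable
  also have "\<dots> = (\<integral>\<^sup>+t. indicator {0<..} t * emeasure M {x \<in> space M. ennreal t < f x} \<partial>lborel)"
  proof (rule nn_integral_cong)
    fix t
    have "(\<integral>\<^sup>+x. indicator {t. 0 < t \<and> ennreal t < f x} t \<partial>M) =
        (\<integral>\<^sup>+x. indicator {0<..} t * indicator {x \<in> space M. ennreal t < f x} x \<partial>M)"
      by (intro nn_integral_cong) (auto split: split_indicator)
    then show "(\<integral>\<^sup>+x. indicator {t. 0 < t \<and> ennreal t < f x} t \<partial>M) =
        indicator {0<..} t * emeasure M {x \<in> space M. ennreal t < f x}"
      by (simp add: nn_integral_cmult)
  qed
  finally show ?thesis .
qed

lemma emeasure_superlevel_add_le_of_min_le:
  fixes f g h :: "real \<Rightarrow> ennreal"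
  assumes [measurable]: "f \<in> borel_measurable borel" "g \<in> borel_measurable borel"
      "h \<in> borel_measurable borel"
    and weights: "0 < r" "0 < s"
    and same_sup: "(SUP x. f x) = (SUP x. g x)"
    and min_le: "\<And>x y. min (f x) (g y) \<le> h (r * x + s * y)"
  shows "ennreal r * emeasure lborel {x. t < f x} + ennreal s * emeasure lborel {x. t < g x}
    \<le> emeasure lborel {x. t < h x}"
proof (cases "t < (SUP x. f x)")
  case True
  moreover from True have "t < (SUP x. g x)" by (simp add: same_sup)
  ultimately have "{x. t < f x} \<noteq> {}" "{x. t < g x} \<noteq> {}"
    by (auto simp: less_SUP_iff)
  moreover have "r * x + s * y \<in> {x. t < h x}" if "x \<in> {x. t < f x}" "y \<in> {x. t < g x}" for x y
    using that less_le_trans[OF _ min_le[of x y]] by auto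
  moreover have "{x. t < f x} \<in> sets borel" "{x. t < g x} \<in> sets borel" "{x. t < h x} \<in> sets borel"
    by measurable
  ultimately show ?thesis
    using brunn_minkowski_real[of "{x. t < f x}" "{x. t < g x}" "{x. t < h x}" r s] weights by simp
next
  case False
  moreover from False have "\<not> t < (SUP x. g x)" by (simp add: same_sup)
  ultimately have "{x. t < f x} = {}" "{x. t < g x} = {}"
    by (auto simp: less_SUP_iff)
  then show ?thesis by simp
qed

lemma nn_integral_add_le_of_min_le:
  fixes f g h :: "real \<Rightarrow> ennreal"
  assumes [measurable]: "f \<in> borel_measurable borel" "g \<in> borel_measurable borel"
      "h \<in> borel_measurable borel"
    and "0 < r" "0 < s"
    and "(SUP x. f x) = (SUP x. g x)"
    and "\<And>x y. min (f x) (g y) \<le> h (r * x + s * y)"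
  shows "ennreal r * (\<integral>\<^sup>+x. f x \<partial>lborel) + ennreal s * (\<integral>\<^sup>+x. g x \<partial>lborel) \<le> (\<integral>\<^sup>+x. h x \<partial>lborel)"
proof -
  define level where "level k t = emeasure lborel {x :: real. ennreal t < k x}"
    for k :: "real \<Rightarrow> ennreal" and t
  have layer_cake: "(\<integral>\<^sup>+x. k x \<partial>lborel) = (\<integral>\<^sup>+t. indicator {0<..} t * level k t \<partial>lborel)"
    and [measurable]: "level k \<in> borel_measurable borel"
    if [measurable]: "k \<in> borel_measurable borel" for k
    using lborel.nn_integral_eq_emeasure_superlevel[of k]
    by (simp_all add: level_def[abs_def]) measurable
  have "ennreal r * (\<integral>\<^sup>+x. f x \<partial>lborel) + ennreal s * (\<integral>\<^sup>+x. g x \<partial>lborel) =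
      (\<integral>\<^sup>+t. ennreal r * (indicator {0<..} t * level f t) +
        ennreal s * (indicator {0<..} t * level g t) \<partial>lborel)"
    by (simp add: layer_cake[of f] layer_cake[of g] nn_integral_cmult nn_integral_add)
  also have "\<dots> =
      (\<integral>\<^sup>+t. indicator {0<..} t * (ennreal r * level f t + ennreal s * level g t) \<partial>lborel)"
    by (simp add: distrib_left mult.left_commute)
  also have "\<dots> \<le> (\<integral>\<^sup>+t. indicator {0<..} t * level h t \<partial>lborel)"
    unfolding level_def
    by (intro nn_integral_mono mult_left_mono emeasure_superlevel_add_le_of_min_le assms) simp
  also have "\<dots> = (\<integral>\<^sup>+x. h x \<partial>lborel)"
    by (rule layer_cake[symmetric]) simp
  finally show ?thesis .
qed

definition weighted_mean :: "nat \<Rightarrow> nat \<Rightarrow> 'a::real_vector \<Rightarrow> 'a \<Rightarrow> 'a" where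
  "weighted_mean p q x y = (real p / real (p + q)) *\<^sub>R x + (real q / real (p + q)) *\<^sub>R y"

lemma power_mult_power_le_weighted_mean:
  fixes x y :: real
  assumes "0 \<le> x" "0 \<le> y"
  shows "x ^ p * y ^ q \<le> weighted_mean p q x y ^ (p + q)"
proof (cases "real p * x + real q * y = 0")
  case True
  then show ?thesis
    using assms by (auto simp: weighted_mean_def add_nonneg_eq_0_iff power_0_left)
next
  case False
  define m where "m = weighted_mean p q x y"
  have m_eq: "m = (real p * x + real q * y) / real (p + q)"
    by (simp add: m_def weighted_mean_def add_divide_distrib)
  have "real (p + q) > 0" using False by (cases "p + q = 0") auto
  then have "m > 0"
    using False assms by (auto simp: m_eq less_le intro!: divide_pos_pos)
  have "(x / m) ^ p * (y / m) ^ q \<le> exp (x / m - 1) ^ p * exp (y / m - 1) ^ q"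
    using assms \<open>m > 0\<close> exp_ge_add_one_self[of "x / m - 1"] exp_ge_add_one_self[of "y / m - 1"]
    by (intro mult_mono power_mono) auto
  also have "\<dots> = exp ((real p * x + real q * y) / m - real (p + q))"
    by (simp add: exp_of_nat_mult[symmetric] mult_exp_exp add_divide_distrib right_diff_distrib)
  also have "(real p * x + real q * y) / m = real (p + q)"
    using \<open>m > 0\<close> \<open>real (p + q) > 0\<close> False by (simp add: m_eq)
  finally have "x ^ p * y ^ q \<le> m ^ p * m ^ q"
    using \<open>m > 0\<close> by (simp add: power_divide divide_le_eq)
  then show ?thesis
    by (simp only: power_add m_def)
qed

lemma ennreal_power_mult_power_le_weighted_mean:
  fixes x y :: ennreal
  assumes "0 < p" "0 < q"
  shows "x ^ p * y ^ q \<le>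
    (ennreal (real p / real (p + q)) * x + ennreal (real q / real (p + q)) * y) ^ (p + q)"
proof (cases "x = top \<or> y = top")
  case True
  then show ?thesis
    using assms by (auto simp: ennreal_mult_top)
next
  case False
  then obtain a b where "x = ennreal a" "0 \<le> a" "y = ennreal b" "0 \<le> b"
    by (cases x; cases y) auto
  then show ?thesis
    using power_mult_power_le_weighted_mean[of a b p q]
    by (auto simp: weighted_mean_def ennreal_power ennreal_mult[symmetric] ennreal_plus[symmetric]
        simp del: ennreal_plus)
qed

lemma ennreal_power_le_imp_le:
  fixes x y :: ennreal
  assumes "0 < n" "x ^ n \<le> y ^ n"
  shows "x \<le> y"
  using assms
  by (cases x; cases y)
    (auto simp: ennreal_power top_power_ennreal top_unique dest: power_le_imp_le_base[of _ "n - 1"])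

text \<open>Weights are rational and enter as exponents because \<^typ>\<open>ennreal\<close> has only natural powers.\<close>

lemma prekopa_leindler_real_same_sup:
  fixes f g h :: "real \<Rightarrow> ennreal"
  assumes "f \<in> borel_measurable borel" "g \<in> borel_measurable borel" "h \<in> borel_measurable borel"
    and "0 < p" "0 < q"
    and "(SUP x. f x) = (SUP x. g x)"
    and pointwise: "\<And>x y. f x ^ p * g y ^ q \<le> h (weighted_mean p q x y) ^ (p + q)"
  shows "(\<integral>\<^sup>+x. f x \<partial>lborel) ^ p * (\<integral>\<^sup>+x. g x \<partial>lborel) ^ q \<le> (\<integral>\<^sup>+x. h x \<partial>lborel) ^ (p + q)"
proof -
  have "min (f x) (g y) \<le> h (weighted_mean p q x y)" for x y
  proof (rule ennreal_power_le_imp_le)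
    have "min (f x) (g y) ^ (p + q) \<le> f x ^ p * g y ^ q"
      unfolding power_add by (intro mult_mono power_mono_ennreal) auto
    then show "min (f x) (g y) ^ (p + q) \<le> h (weighted_mean p q x y) ^ (p + q)"
      using pointwise by (rule order_trans)
  qed (use \<open>0 < p\<close> in simp)
  then have "ennreal (real p / real (p + q)) * (\<integral>\<^sup>+x. f x \<partial>lborel)
      + ennreal (real q / real (p + q)) * (\<integral>\<^sup>+x. g x \<partial>lborel) \<le> (\<integral>\<^sup>+x. h x \<partial>lborel)"
    using assms(1-6) by (intro nn_integral_add_le_of_min_le) (auto simp: weighted_mean_def)
  then show ?thesis
    by (intro order_trans[OF ennreal_power_mult_power_le_weighted_mean power_mono_ennreal] assms(4,5))
qed

lemma prekopa_leindler_real_bounded: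
  fixes f g h :: "real \<Rightarrow> ennreal"
  assumes [measurable]: "f \<in> borel_measurable borel" "g \<in> borel_measurable borel"
      "h \<in> borel_measurable borel"
    and "0 < p" "0 < q"
    and bounded: "(SUP x. f x) < top" "(SUP x. g x) < top"
    and pointwise: "\<And>x y. f x ^ p * g y ^ q \<le> h (weighted_mean p q x y) ^ (p + q)"
  shows "(\<integral>\<^sup>+x. f x \<partial>lborel) ^ p * (\<integral>\<^sup>+x. g x \<partial>lborel) ^ q \<le> (\<integral>\<^sup>+x. h x \<partial>lborel) ^ (p + q)"
proof (cases "(SUP x. f x) = 0 \<or> (SUP x. g x) = 0")
  case True
  then have "(\<forall>x. f x = 0) \<or> (\<forall>x. g x = 0)"
    by (simp flip: bot_ennreal)
  then show ?thesis
    using assms(4,5) by (auto simp: power_0_left)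
next
  case False
  obtain a b :: real where sup: "(SUP x. f x) = ennreal a" "(SUP x. g x) = ennreal b"
    and "0 < a" "0 < b"
    using bounded False by (cases "SUP x. f x"; cases "SUP x. g x") (auto simp: less_le)
  define c where "c = root (p + q) (a ^ p * b ^ q)"
  have "0 < c" and c_power: "c ^ (p + q) = a ^ p * b ^ q"
    using \<open>0 < a\<close> \<open>0 < b\<close> \<open>0 < p\<close> by (simp_all add: c_def)
  define \<alpha> \<beta> \<gamma> where "\<alpha> = ennreal (1 / a)" and "\<beta> = ennreal (1 / b)" and "\<gamma> = ennreal (1 / c)"
  have scales: "\<alpha> ^ p * \<beta> ^ q = \<gamma> ^ (p + q)"
    using \<open>0 < a\<close> \<open>0 < b\<close> \<open>0 < c\<close> c_power
    by (simp add: \<alpha>_def \<beta>_def \<gamma>_def ennreal_power ennreal_mult[symmetric] power_divide)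
  have scale: "(\<alpha> * x) ^ p * (\<beta> * y) ^ q = \<gamma> ^ (p + q) * (x ^ p * y ^ q)" for x y
    unfolding scales[symmetric] by (simp add: power_mult_distrib mult_ac)
  have "(SUP x. \<alpha> * f x) = (SUP x. \<beta> * g x)"
    using \<open>0 < a\<close> \<open>0 < b\<close> sup
    by (simp add: \<alpha>_def \<beta>_def ennreal_mult[symmetric] flip: SUP_mult_left_ennreal)
  then have "(\<integral>\<^sup>+x. \<alpha> * f x \<partial>lborel) ^ p * (\<integral>\<^sup>+x. \<beta> * g x \<partial>lborel) ^ q
      \<le> (\<integral>\<^sup>+x. \<gamma> * h x \<partial>lborel) ^ (p + q)"
    using mult_left_mono[OF pointwise, of "\<gamma> ^ (p + q)"]
    by (intro prekopa_leindler_real_same_sup assms(4,5))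
      (simp_all add: scale power_mult_distrib[of \<gamma>])
  then have "\<gamma> ^ (p + q) * ((\<integral>\<^sup>+x. f x \<partial>lborel) ^ p * (\<integral>\<^sup>+x. g x \<partial>lborel) ^ q)
      \<le> \<gamma> ^ (p + q) * (\<integral>\<^sup>+x. h x \<partial>lborel) ^ (p + q)"
    by (simp add: nn_integral_cmult scale power_mult_distrib[of \<gamma>])
  then show ?thesis
    using \<open>0 < c\<close> by (simp add: ennreal_mult_le_mult_iff ennreal_power \<gamma>_def)
qed

lemma tendsto_power_ennreal:
  fixes u :: "'a \<Rightarrow> ennreal"
  assumes "(u \<longlongrightarrow> l) F"
  shows "((\<lambda>x. u x ^ n) \<longlongrightarrow> l ^ n) F"
proof (induction n)
  case (Suc n)
  have "\<not> (l = 0 \<and> l ^ n = \<infinity> \<or> l = \<infinity> \<and> l ^ n = 0)"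
    by (auto simp: power_eq_top_ennreal power_0_left top_power_ennreal split: if_splits)
  then show ?case
    using tendsto_mult_ennreal[OF assms Suc.IH] by simp
qed simp

theorem prekopa_leindler_real:
  fixes f g h :: "real \<Rightarrow> ennreal"
  assumes [measurable]: "f \<in> borel_measurable borel" "g \<in> borel_measurable borel"
      "h \<in> borel_measurable borel"
    and "0 < p" "0 < q"
    and pointwise: "\<And>x y. f x ^ p * g y ^ q \<le> h (weighted_mean p q x y) ^ (p + q)"
  shows "(\<integral>\<^sup>+x. f x \<partial>lborel) ^ p * (\<integral>\<^sup>+x. g x \<partial>lborel) ^ q \<le> (\<integral>\<^sup>+x. h x \<partial>lborel) ^ (p + q)"
    (is "?F ^ p * ?G ^ q \<le> ?H ^ (p + q)")
proof (cases "?F = 0 \<or> ?G = 0")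
  case True
  then show ?thesis using assms(4,5) by (auto simp: power_0_left)
next
  case False
  define trunc where "trunc k n x = min (k x) (of_nat n)"
    for k :: "real \<Rightarrow> ennreal" and n :: nat and x
  have trunc_tendsto: "(\<lambda>n. \<integral>\<^sup>+x. trunc k n x \<partial>lborel) \<longlonglongrightarrow> (\<integral>\<^sup>+x. k x \<partial>lborel)"
    if [measurable]: "k \<in> borel_measurable borel" for k
  proof (rule nn_integral_LIMSEQ)
    show "incseq (trunc k)"
      unfolding incseq_def le_fun_def trunc_def by (intro allI impI min.mono order_refl of_nat_mono)
    show "(\<lambda>n. trunc k n x) \<longlonglongrightarrow> k x" for x
      using tendsto_min[OF tendsto_const of_nat_tendsto_top_ennreal, of "k x"]
      by (simp add: trunc_def)
  qed (simp add: trunc_def)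
  have "(\<integral>\<^sup>+x. trunc f n x \<partial>lborel) ^ p * (\<integral>\<^sup>+x. trunc g n x \<partial>lborel) ^ q \<le> ?H ^ (p + q)" for n
  proof (rule prekopa_leindler_real_bounded)
    have "(SUP x. trunc k n x) \<le> of_nat n" for k
      by (auto simp: trunc_def intro: SUP_least)
    then show "(SUP x. trunc f n x) < top" "(SUP x. trunc g n x) < top"
      using le_less_trans of_nat_less_top by blast+
    show "trunc f n x ^ p * trunc g n y ^ q \<le> h (weighted_mean p q x y) ^ (p + q)" for x y
      by (rule order_trans[OF mult_mono pointwise]) (auto simp: trunc_def intro: power_mono_ennreal)
  qed (use \<open>0 < p\<close> \<open>0 < q\<close> in \<open>simp_all add: trunc_def\<close>)
  moreover have "(\<lambda>n. (\<integral>\<^sup>+x. trunc f n x \<partial>lborel) ^ p * (\<integral>\<^sup>+x. trunc g n x \<partial>lborel) ^ q)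
      \<longlonglongrightarrow> ?F ^ p * ?G ^ q"
    by (intro tendsto_mult_ennreal tendsto_power_ennreal trunc_tendsto) (use False in auto)
  ultimately show ?thesis
    by (intro LIMSEQ_le_const2) auto
qed

lemma borel_measurable_PiM_fun_upd:
  assumes [measurable]: "k \<in> borel_measurable (PiM (insert i I) (\<lambda>_. lborel :: real measure))"
    and "w \<in> extensional I"
  shows "(\<lambda>t. k (w(i := t))) \<in> borel_measurable borel"
proof -
  have "w \<in> space (PiM I (\<lambda>_. lborel :: real measure))"
    using assms(2) by (simp add: space_PiM PiE_def)
  then show ?thesis by measurable
qed

theorem prekopa_leindler_PiM:
  fixes f g h :: "('i \<Rightarrow> real) \<Rightarrow> ennreal"
  assumes "finite I" "0 < p" "0 < q"
    and "f \<in> borel_measurable (PiM I (\<lambda>_. lborel))" "g \<in> borel_measurable (PiM I (\<lambda>_. lborel))"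
      "h \<in> borel_measurable (PiM I (\<lambda>_. lborel))"
    and "\<And>x y. x \<in> extensional I \<Longrightarrow> y \<in> extensional I \<Longrightarrow>
      f x ^ p * g y ^ q \<le> h (\<lambda>i\<in>I. weighted_mean p q (x i) (y i)) ^ (p + q)"
  shows "(\<integral>\<^sup>+x. f x \<partial>PiM I (\<lambda>_. lborel)) ^ p * (\<integral>\<^sup>+x. g x \<partial>PiM I (\<lambda>_. lborel)) ^ q
    \<le> (\<integral>\<^sup>+x. h x \<partial>PiM I (\<lambda>_. lborel)) ^ (p + q)"
  using assms(1,4-)
proof (induction I arbitrary: f g h rule: finite_induct)
  case empty
  then show ?case
    using empty(4)[of "\<lambda>_. undefined" "\<lambda>_. undefined"]
    by (simp add: PiM_empty nn_integral_count_space_finite restrict_def)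
next
  case (insert i I)
  interpret product_sigma_finite "\<lambda>_. lborel :: real measure" ..
  note [measurable] = insert.prems(1-3)
  let ?marginal = "\<lambda>k x. \<integral>\<^sup>+t. k (x(i := t)) \<partial>lborel"
  have "(\<integral>\<^sup>+x. ?marginal f x \<partial>PiM I (\<lambda>_. lborel)) ^ p * (\<integral>\<^sup>+x. ?marginal g x \<partial>PiM I (\<lambda>_. lborel)) ^ q
      \<le> (\<integral>\<^sup>+x. ?marginal h x \<partial>PiM I (\<lambda>_. lborel)) ^ (p + q)"
  proof (rule insert.IH)
    fix x y :: "'i \<Rightarrow> real" assume x: "x \<in> extensional I" and y: "y \<in> extensional I"
    let ?z = "\<lambda>j\<in>I. weighted_mean p q (x j) (y j)"
    have "f (x(i := s)) ^ p * g (y(i := t)) ^ q \<le> h (?z(i := weighted_mean p q s t)) ^ (p + q)" for s t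
    proof -
      have combination: "(\<lambda>j\<in>insert i I. weighted_mean p q ((x(i := s)) j) ((y(i := t)) j)) =
          ?z(i := weighted_mean p q s t)"
        using insert.hyps by (auto simp: fun_eq_iff)
      have "x(i := s) \<in> extensional (insert i I)" "y(i := t) \<in> extensional (insert i I)"
        using x y by (auto simp: extensional_def)
      from insert.prems(4)[OF this] show ?thesis by (simp only: combination)
    qed
    moreover have "?z \<in> extensional I" by (rule restrict_extensional)
    ultimately show "?marginal f x ^ p * ?marginal g y ^ q \<le> ?marginal h ?z ^ (p + q)"
      using assms(2,3) x y insert.prems(1-3)
      by (intro prekopa_leindler_real borel_measurable_PiM_fun_upd)
  qed measurable
  then show ?case
    using insert.prems(1-3) by (simp only: product_nn_integral_insert[OF insert.hyps])
qed

theorem prekopa_leindler: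
  fixes f g h :: "'a::euclidean_space \<Rightarrow> ennreal"
  assumes [measurable]: "f \<in> borel_measurable borel" "g \<in> borel_measurable borel"
      "h \<in> borel_measurable borel"
    and "0 < p" "0 < q"
    and pointwise: "\<And>x y. f x ^ p * g y ^ q \<le> h (weighted_mean p q x y) ^ (p + q)"
  shows "(\<integral>\<^sup>+x. f x \<partial>lborel) ^ p * (\<integral>\<^sup>+x. g x \<partial>lborel) ^ q \<le> (\<integral>\<^sup>+x. h x \<partial>lborel) ^ (p + q)"
proof -
  let ?P = "PiM Basis (\<lambda>_. lborel) :: ('a \<Rightarrow> real) measure"
  let ?v = "\<lambda>x. \<Sum>b\<in>Basis. x b *\<^sub>R b :: 'a"
  have coordinates: "(\<integral>\<^sup>+x. k x \<partial>lborel) = (\<integral>\<^sup>+x. k (?v x) \<partial>?P)"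
    if [measurable]: "k \<in> borel_measurable borel" for k :: "'a \<Rightarrow> ennreal"
    by (subst lborel_eq) (simp add: nn_integral_distr)
  have "?v (\<lambda>b\<in>Basis. weighted_mean p q (x b) (y b)) = weighted_mean p q (?v x) (?v y)" for x y
    by (simp add: weighted_mean_def scaleR_add_left sum.distrib scaleR_sum_right)
  then show ?thesis
    using pointwise assms(4,5)
    by (simp only: coordinates assms(1-3)) (rule prekopa_leindler_PiM; simp)
qed

subsection \<open>Concentration for isotropic normal measures\<close>

definition isotropic_normal :: "real \<Rightarrow> (real ^ 'n) measure" where
  "isotropic_normal s = density lborel (\<lambda>x. ennreal (isotropic_normal_density s x))"

lemma isotropic_normal_density_nonneg [simp]: "0 \<le> isotropic_normal_density s x"
  by (simp add: isotropic_normal_density_def prod_nonneg)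

lemma borel_measurable_isotropic_normal_density [measurable]:
  "isotropic_normal_density s \<in> borel_measurable borel"
  unfolding isotropic_normal_density_def[abs_def] by measurable

lemma sets_isotropic_normal [simp, measurable_cong]: "sets (isotropic_normal s) = sets borel"
  and space_isotropic_normal [simp]: "space (isotropic_normal s) = UNIV"
  by (simp_all add: isotropic_normal_def)

lemma nn_integral_isotropic_normal:
  assumes [measurable]: "f \<in> borel_measurable borel"
  shows "(\<integral>\<^sup>+x. f x \<partial>isotropic_normal s) =
    (\<integral>\<^sup>+x. f x * ennreal (isotropic_normal_density s x) \<partial>lborel)"
  unfolding isotropic_normal_def by (subst nn_integral_density) (auto simp: mult.commute)

lemma nn_integral_lborel_vec_prod:
  fixes f :: "'n::finite \<Rightarrow> real \<Rightarrow> ennreal"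
  assumes "\<And>i. f i \<in> borel_measurable borel"
  shows "(\<integral>\<^sup>+(x::real ^ 'n). (\<Prod>i\<in>UNIV. f i (x $ i)) \<partial>lborel) = (\<Prod>i\<in>UNIV. \<integral>\<^sup>+t. f i t \<partial>lborel)"
proof -
  have reindex: "(\<Prod>b\<in>(Basis :: (real ^ 'n) set). g (axis_index b) b) = (\<Prod>i\<in>UNIV. g i (axis i 1))"
    for g :: "'n \<Rightarrow> real ^ 'n \<Rightarrow> ennreal"
    by (rule prod.reindex_bij_witness[where i="\<lambda>i. axis i 1" and j=axis_index])
      (auto simp: Basis_vec_def axis_index_axis)
  have "(\<integral>\<^sup>+(x::real ^ 'n). (\<Prod>i\<in>UNIV. f i (x $ i)) \<partial>lborel) =
      (\<integral>\<^sup>+(x::real ^ 'n). (\<Prod>b\<in>Basis. f (axis_index b) (x \<bullet> b)) \<partial>lborel)"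
    using reindex[of "\<lambda>i b. f i (x \<bullet> b)" for x] by (simp add: inner_axis)
  also have "\<dots> = (\<Prod>b\<in>(Basis :: (real ^ 'n) set). \<integral>\<^sup>+t. f (axis_index b) t \<partial>lborel)"
    using assms by (intro nn_integral_lborel_prod) auto
  also have "\<dots> = (\<Prod>i\<in>UNIV. \<integral>\<^sup>+t. f i t \<partial>lborel)"
    using reindex[of "\<lambda>i b. \<integral>\<^sup>+t. f i t \<partial>lborel"] by simp
  finally show ?thesis .
qed

lemma nn_integral_isotropic_normal_component:
  fixes i :: "'n::finite"
  assumes "s > 0" and [measurable]: "f \<in> borel_measurable borel"
  shows "(\<integral>\<^sup>+(x::real ^ 'n). f (x $ i) \<partial>isotropic_normal s) =
    (\<integral>\<^sup>+t. f t * ennreal (normal_density 0 s t) \<partial>lborel)"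
proof -
  define factor where "factor j t = (if j = i then f t else 1) * ennreal (normal_density 0 s t)"
    for j t
  have [measurable]: "factor j \<in> borel_measurable borel" for j
    unfolding factor_def[abs_def] by measurable
  have "(\<integral>\<^sup>+(x::real ^ 'n). f (x $ i) \<partial>isotropic_normal s) =
      (\<integral>\<^sup>+(x::real ^ 'n). (\<Prod>j\<in>UNIV. factor j (x $ j)) \<partial>lborel)"
    by (simp add: nn_integral_isotropic_normal isotropic_normal_density_def factor_def prod.distrib
        prod.delta prod_ennreal)
  also have "\<dots> = (\<Prod>j\<in>UNIV. \<integral>\<^sup>+t. factor j t \<partial>lborel)"
    by (rule nn_integral_lborel_vec_prod) measurable
  also have "\<dots> = (\<Prod>j\<in>UNIV. if j = i then \<integral>\<^sup>+t. f t * ennreal (normal_density 0 s t) \<partial>lborel else 1)"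
    using \<open>s > 0\<close> by (intro prod.cong refl) (simp add: factor_def nn_integral_eq_integral)
  also have "\<dots> = (\<integral>\<^sup>+t. f t * ennreal (normal_density 0 s t) \<partial>lborel)"
    by (simp add: prod.delta)
  finally show ?thesis .
qed

lemma prob_space_isotropic_normal:
  assumes "s > 0"
  shows "prob_space (isotropic_normal s)"
proof (rule prob_spaceI)
  show "emeasure (isotropic_normal s) (space (isotropic_normal s :: (real ^ 'n) measure)) = 1"
    using nn_integral_isotropic_normal_component[OF assms, of "\<lambda>_. 1" undefined] assms
    by (simp add: nn_integral_eq_integral)
qed

lemma distr_scaleR_isotropic_normal:
  assumes "s > 0"
  shows "distr (isotropic_normal 1) borel (\<lambda>x::real ^ 'n. s *\<^sub>R x) = isotropic_normal s"
proof -
  have density_scaleR: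
    "s ^ CARD('n) * isotropic_normal_density s (s *\<^sub>R x) = isotropic_normal_density 1 x"
    for x :: "real ^ 'n"
    using assms
    by (simp add: isotropic_normal_density_def normal_density_def real_sqrt_mult power_mult_distrib
        flip: prod_constant prod.distrib)
  have "isotropic_normal s = density (distr lborel borel (\<lambda>x::real ^ 'n. s *\<^sub>R x))
      (\<lambda>x. ennreal (s ^ CARD('n) * isotropic_normal_density s x))"
    unfolding isotropic_normal_def using assms
    by (subst lborel_affine[of s 0]) (auto simp: density_density_eq ennreal_mult ennreal_power)
  also have "\<dots> = distr (density lborel
      (\<lambda>x::real ^ 'n. ennreal (s ^ CARD('n) * isotropic_normal_density s (s *\<^sub>R x))))
      borel (\<lambda>x. s *\<^sub>R x)"
    by (rule density_distr) measurable
  finally show ?thesis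
    by (simp add: isotropic_normal_def density_scaleR)
qed

lemma norm_vec_power2: "(norm (x :: real ^ 'n))\<^sup>2 = (\<Sum>i\<in>UNIV. (x $ i)\<^sup>2)"
  by (simp add: power2_norm_eq_inner inner_vec_def) (simp add: power2_eq_square)

lemma integrable_norm_power2_isotropic_normal:
  assumes "s > 0"
  shows "integrable (isotropic_normal s) (\<lambda>x::real ^ 'n. (norm x)\<^sup>2)"
proof -
  have "integrable (isotropic_normal s) (\<lambda>x::real ^ 'n. (x $ i)\<^sup>2)" for i
  proof (rule integrableI_bounded)
    have "(\<integral>\<^sup>+(x::real ^ 'n). ennreal (norm ((x $ i)\<^sup>2)) \<partial>isotropic_normal s) =
        (\<integral>\<^sup>+t. ennreal (normal_density 0 s t * t\<^sup>2) \<partial>lborel)"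
      using nn_integral_isotropic_normal_component[OF assms, of "\<lambda>t. ennreal (norm (t\<^sup>2))" i]
      by (simp add: ennreal_mult'[symmetric] mult.commute)
    also have "\<dots> < \<infinity>"
      using integrable_normal_moment[OF assms, of 0 2] by (simp add: nn_integral_eq_integral)
    finally show "(\<integral>\<^sup>+(x::real ^ 'n). ennreal (norm ((x $ i)\<^sup>2)) \<partial>isotropic_normal s) < \<infinity>" .
  qed measurable
  then show ?thesis by (simp add: norm_vec_power2)
qed

lemma borel_measurable_lipschitz:
  "L-lipschitz_on UNIV F \<Longrightarrow> F \<in> borel_measurable borel"
  by (rule borel_measurable_continuous_onI[OF lipschitz_on_continuous_on])

lemma integrable_lipschitz_isotropic_normal:
  fixes F :: "real ^ 'n \<Rightarrow> real"
  assumes "s > 0" and lipschitz: "L-lipschitz_on UNIV F"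
  shows "integrable (isotropic_normal s) F"
proof (rule Bochner_Integration.integrable_bound)
  interpret prob_space "isotropic_normal s :: (real ^ 'n) measure"
    by (rule prob_space_isotropic_normal[OF assms(1)])
  show "integrable (isotropic_normal s) (\<lambda>x::real ^ 'n. \<bar>F 0\<bar> + L * (1 + (norm x)\<^sup>2))"
    using assms(1) by (simp add: integrable_norm_power2_isotropic_normal)
  show "F \<in> borel_measurable (isotropic_normal s)"
    using borel_measurable_lipschitz[OF lipschitz] by simp
  have "\<bar>F x\<bar> \<le> \<bar>F 0\<bar> + L * (1 + (norm x)\<^sup>2)" for x
  proof -
    have "2 * norm x \<le> 1 + (norm x)\<^sup>2"
      using zero_le_power2[of "norm x - 1"] by (simp add: power2_diff)
    then have "norm x \<le> 1 + (norm x)\<^sup>2"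
      using norm_ge_zero[of x] by linarith
    then have "L * norm x \<le> L * (1 + (norm x)\<^sup>2)"
      using lipschitz_on_nonneg[OF lipschitz] by (rule mult_left_mono)
    then show ?thesis
      using lipschitz_onD[OF lipschitz, of x 0] by (simp add: dist_norm)
  qed
  then show "AE x in isotropic_normal s. norm (F x) \<le> norm (\<bar>F 0\<bar> + L * (1 + (norm x)\<^sup>2))"
    by (auto intro!: AE_I2 intro: order_trans[OF _ abs_ge_self])
qed

lemma isotropic_normal_density_eq_exp:
  fixes x :: "real ^ 'n"
  shows "isotropic_normal_density s x =
    (1 / sqrt (2 * pi * s\<^sup>2)) ^ CARD('n) * exp (- (norm x)\<^sup>2 / (2 * s\<^sup>2))"
proof -
  have "isotropic_normal_density s x =
      (1 / sqrt (2 * pi * s\<^sup>2)) ^ CARD('n) * (\<Prod>i\<in>UNIV. exp (- (x $ i)\<^sup>2 / (2 * s\<^sup>2)))"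
    unfolding isotropic_normal_density_def normal_density_def
    by (simp only: prod.distrib prod_constant diff_zero)
  also have "(\<Prod>i\<in>UNIV. exp (- (x $ i)\<^sup>2 / (2 * s\<^sup>2))) = exp (- (norm x)\<^sup>2 / (2 * s\<^sup>2))"
    by (simp add: exp_sum[symmetric] sum_divide_distrib[symmetric] sum_negf norm_vec_power2)
  finally show ?thesis .
qed

lemma norm_power2_convex_combination:
  fixes x y :: "'a::real_inner"
  assumes "r + t = 1"
  shows "(norm (r *\<^sub>R x + t *\<^sub>R y))\<^sup>2 = r * (norm x)\<^sup>2 + t * (norm y)\<^sup>2 - r * t * (norm (x - y))\<^sup>2"
proof -
  have t: "t = 1 - r" using assms by simp
  show ?thesis
    unfolding t power2_norm_eq_inner
    by (simp add: inner_add_left inner_add_right inner_diff_left inner_diff_right inner_commute)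
      (simp add: algebra_simps)
qed

lemma isotropic_normal_density_power_mult_power:
  assumes "0 < p + q"
  shows "isotropic_normal_density s x ^ p * isotropic_normal_density s y ^ q =
    isotropic_normal_density s (weighted_mean p q x y) ^ (p + q) *
      exp (- (real p * real q / real (p + q)) * (norm (x - y))\<^sup>2 / (2 * s\<^sup>2))"
proof -
  define N where "N = real (p + q)"
  define z where "z = weighted_mean p q x y"
  have "N > 0" using assms unfolding N_def of_nat_0_less_iff .
  then have "real p / N + real q / N = 1"
    by (simp add: N_def add_divide_distrib[symmetric])
  from norm_power2_convex_combination[OF this, of x y]
  have "N * (norm z)\<^sup>2 = N * (real p / N * (norm x)\<^sup>2 + real q / N * (norm y)\<^sup>2 -
      real p / N * (real q / N) * (norm (x - y))\<^sup>2)"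
    by (simp add: z_def weighted_mean_def N_def)
  also have "\<dots> = real p * (norm x)\<^sup>2 + real q * (norm y)\<^sup>2 - real p * real q / N * (norm (x - y))\<^sup>2"
    using \<open>N > 0\<close> by (simp add: field_simps)
  finally have "real p * (norm x)\<^sup>2 + real q * (norm y)\<^sup>2 =
      N * (norm z)\<^sup>2 + real p * real q / N * (norm (x - y))\<^sup>2" by simp
  then have "- (real p * (norm x)\<^sup>2 + real q * (norm y)\<^sup>2) / (2 * s\<^sup>2) =
      - (N * (norm z)\<^sup>2 + real p * real q / N * (norm (x - y))\<^sup>2) / (2 * s\<^sup>2)" by simp
  then have "real p * (- (norm x)\<^sup>2 / (2 * s\<^sup>2)) + real q * (- (norm y)\<^sup>2 / (2 * s\<^sup>2)) =
      N * (- (norm z)\<^sup>2 / (2 * s\<^sup>2)) + - (real p * real q / N) * (norm (x - y))\<^sup>2 / (2 * s\<^sup>2)"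
    by (simp add: add_divide_distrib diff_divide_distrib)
  then have "exp (- (norm x)\<^sup>2 / (2 * s\<^sup>2)) ^ p * exp (- (norm y)\<^sup>2 / (2 * s\<^sup>2)) ^ q =
      exp (- (norm z)\<^sup>2 / (2 * s\<^sup>2)) ^ (p + q) *
        exp (- (real p * real q / N) * (norm (x - y))\<^sup>2 / (2 * s\<^sup>2))"
    by (simp only: exp_of_nat_mult[symmetric] exp_add[symmetric] N_def)
  then show ?thesis
    unfolding N_def[symmetric] z_def[symmetric] isotropic_normal_density_eq_exp power_mult_distrib
    by (simp add: power_add mult_ac)
qed

text \<open>
  The constant is the maximum of \<open>L * d - n / (n + 1) * d\<^sup>2 / (2 * s\<^sup>2)\<close> over \<open>d = norm (x - y)\<close>,
  where the subtracted term is the gain from the strong log-concavity of the density.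
\<close>

lemma lipschitz_isotropic_normal_density_tilt:
  fixes F :: "real ^ 'n \<Rightarrow> real" and n :: nat
  assumes "s > 0" and lipschitz: "L-lipschitz_on UNIV F" and "n > 0"
  shows "exp (F x) * isotropic_normal_density s x * (exp (- F y / n) * isotropic_normal_density s y) ^ n
    \<le> exp (L\<^sup>2 * s\<^sup>2 * (1 + 1 / n) / 2) *
      isotropic_normal_density s (weighted_mean 1 n x y) ^ (1 + n)"
proof -
  define k where "k = 1 + 1 / real n"
  define c where "c = L\<^sup>2 * s\<^sup>2 * k / 2"
  define defect where "defect = real n / real (1 + n) * (norm (x - y))\<^sup>2 / (2 * s\<^sup>2)"
  define z where "z = weighted_mean 1 n x y"
  have "k > 0" and "real n / real (1 + n) = 1 / k"
    using \<open>n > 0\<close> by (simp_all add: k_def field_simps add_pos_pos)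
  then have defect_eq: "defect = 1 / k * (norm (x - y))\<^sup>2 / (2 * s\<^sup>2)"
    by (simp only: defect_def)
  have "0 \<le> (k * s\<^sup>2 * L - norm (x - y))\<^sup>2 / (2 * k * s\<^sup>2)"
    using \<open>k > 0\<close> by simp
  also have "\<dots> = c + defect - L * norm (x - y)"
    using \<open>k > 0\<close> \<open>s > 0\<close> by (simp add: c_def defect_eq power2_eq_square field_simps)
  finally have "F x - F y - defect \<le> c"
    using lipschitz_onD[OF lipschitz, of x y] by (simp add: dist_norm)
  have dual_power: "exp (- (F y / n)) ^ n = exp (- F y)"
    using \<open>n > 0\<close> by (simp add: exp_of_nat_mult[symmetric])
  have "exp (F x) * isotropic_normal_density s x * (exp (- F y / n) * isotropic_normal_density s y) ^ n =
      exp (F x - F y) * (isotropic_normal_density s x * isotropic_normal_density s y ^ n)"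
    using mult_exp_exp[of "F x" "- F y"]
    by (simp add: power_mult_distrib dual_power mult.assoc mult.left_commute)
  also have "isotropic_normal_density s x * isotropic_normal_density s y ^ n =
      isotropic_normal_density s z ^ (1 + n) * exp (- defect)"
    using isotropic_normal_density_power_mult_power[of 1 n s x y]
    by (simp add: z_def defect_def del: power_Suc)
  also have "exp (F x - F y) * (isotropic_normal_density s z ^ (1 + n) * exp (- defect)) =
      exp (F x - F y - defect) * isotropic_normal_density s z ^ (1 + n)"
    by (simp add: exp_diff exp_minus divide_inverse)
  also have "\<dots> \<le> exp c * isotropic_normal_density s z ^ (1 + n)"
    using \<open>F x - F y - defect \<le> c\<close> by (intro mult_right_mono) auto
  finally show ?thesis by (simp only: c_def k_def z_def)
qed

lemma nn_integral_exp_lipschitz_mult_dual_le: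
  fixes F :: "real ^ 'n \<Rightarrow> real" and n :: nat
  assumes "s > 0" and lipschitz: "L-lipschitz_on UNIV F" and "n > 0"
  shows "(\<integral>\<^sup>+x. ennreal (exp (F x)) \<partial>isotropic_normal s) *
      (\<integral>\<^sup>+x. ennreal (exp (- F x / n)) \<partial>isotropic_normal s) ^ n
    \<le> ennreal (exp (L\<^sup>2 * s\<^sup>2 * (1 + 1 / n) / 2))"
proof -
  interpret prob_space "isotropic_normal s :: (real ^ 'n) measure"
    by (rule prob_space_isotropic_normal[OF \<open>s > 0\<close>])
  define c where "c = L\<^sup>2 * s\<^sup>2 * (1 + 1 / n) / 2"
  define \<kappa> where "\<kappa> = ennreal (exp (c / (1 + n)))"
  have \<kappa>_power: "\<kappa> ^ Suc n = ennreal (exp c)"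
    by (simp add: \<kappa>_def ennreal_power exp_of_nat_mult[symmetric] del: power_Suc of_nat_Suc)
  let ?\<phi> = "\<lambda>x::real ^ 'n. ennreal (isotropic_normal_density s x)"
  note [measurable] = borel_measurable_lipschitz[OF lipschitz]
  have "(\<integral>\<^sup>+x. ennreal (exp (F x)) * ?\<phi> x \<partial>lborel) ^ 1 *
      (\<integral>\<^sup>+x. ennreal (exp (- F x / n)) * ?\<phi> x \<partial>lborel) ^ n \<le> (\<integral>\<^sup>+x. \<kappa> * ?\<phi> x \<partial>lborel) ^ (1 + n)"
  proof (rule prekopa_leindler)
    show "(ennreal (exp (F x)) * ?\<phi> x) ^ 1 * (ennreal (exp (- F y / n)) * ?\<phi> y) ^ n
        \<le> (\<kappa> * ?\<phi> (weighted_mean 1 n x y)) ^ (1 + n)" for x y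
      using ennreal_leI[OF lipschitz_isotropic_normal_density_tilt[OF assms, of x y]]
      by (simp add: power_mult_distrib[of \<kappa>] \<kappa>_power c_def ennreal_power ennreal_mult[symmetric]
          del: power_Suc)
  qed (use \<open>n > 0\<close> in auto)
  also have "(\<integral>\<^sup>+x. \<kappa> * ?\<phi> x \<partial>lborel) = \<kappa>"
    using emeasure_space_1 by (simp add: nn_integral_cmult isotropic_normal_def emeasure_density)
  finally show ?thesis
    using \<kappa>_power by (simp add: nn_integral_isotropic_normal c_def)
qed

lemma (in prob_space) exp_expectation_le_nn_integral_exp:
  fixes X :: "'a \<Rightarrow> real"
  assumes "integrable M X"
  shows "ennreal (exp (expectation X)) \<le> (\<integral>\<^sup>+x. ennreal (exp (X x)) \<partial>M)"
proof (cases "integrable M (\<lambda>x. exp (X x))")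
  case True
  then show ?thesis
    using jensens_inequality[OF assms _ _ True exp_convex]
    by (simp add: nn_integral_eq_integral ennreal_leI)
next
  case False
  then have "(\<integral>\<^sup>+x. ennreal (exp (X x)) \<partial>M) = \<infinity>"
    using assms by (auto simp: integrable_iff_bounded simp flip: top.not_eq_extremum)
  then show ?thesis by simp
qed

theorem nn_integral_exp_lipschitz_isotropic_normal_le:
  fixes F :: "real ^ 'n \<Rightarrow> real"
  assumes "s > 0" and lipschitz: "L-lipschitz_on UNIV F"
  shows "(\<integral>\<^sup>+x. ennreal (exp (F x)) \<partial>isotropic_normal s)
    \<le> ennreal (exp ((\<integral>x. F x \<partial>isotropic_normal s) + L\<^sup>2 * s\<^sup>2 / 2))"
proof -
  interpret prob_space "isotropic_normal s :: (real ^ 'n) measure"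
    by (rule prob_space_isotropic_normal[OF assms(1)])
  let ?I = "\<integral>\<^sup>+x. ennreal (exp (F x)) \<partial>isotropic_normal s"
  have F_integrable: "integrable (isotropic_normal s) F"
    by (rule integrable_lipschitz_isotropic_normal[OF assms])
  have bound_with_slack: "?I \<le> ennreal (exp (expectation F + L\<^sup>2 * s\<^sup>2 * (1 + 1 / Suc n) / 2))" for n
  proof -
    have "ennreal (exp (- expectation F)) = ennreal (exp (expectation (\<lambda>x. - F x / Suc n))) ^ Suc n"
      by (simp add: ennreal_power exp_of_nat_mult[symmetric] del: power_Suc of_nat_Suc)
    also have "\<dots> \<le> (\<integral>\<^sup>+x. ennreal (exp (- F x / Suc n)) \<partial>isotropic_normal s) ^ Suc n"
      using F_integrable by (intro power_mono_ennreal exp_expectation_le_nn_integral_exp) auto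
    finally have "?I * ennreal (exp (- expectation F)) \<le>
        ennreal (exp (L\<^sup>2 * s\<^sup>2 * (1 + 1 / Suc n) / 2))"
      by (intro order_trans[OF mult_left_mono nn_integral_exp_lipschitz_mult_dual_le[OF assms]])
        auto
    then have "ennreal (exp (expectation F)) * (?I * ennreal (exp (- expectation F))) \<le>
        ennreal (exp (expectation F)) * ennreal (exp (L\<^sup>2 * s\<^sup>2 * (1 + 1 / Suc n) / 2))"
      by (rule mult_left_mono) simp
    also have "ennreal (exp (expectation F)) * (?I * ennreal (exp (- expectation F))) = ?I"
      by (simp add: mult.left_commute[of _ ?I] ennreal_mult[symmetric] mult_exp_exp)
    finally show ?thesis
      by (simp add: ennreal_mult[symmetric] mult_exp_exp)
  qed
  have "(\<lambda>n. ennreal (exp (expectation F + L\<^sup>2 * s\<^sup>2 * (1 + 1 / Suc n) / 2)))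
      \<longlonglongrightarrow> ennreal (exp (expectation F + L\<^sup>2 * s\<^sup>2 * (1 + 0) / 2))"
    using LIMSEQ_inverse_real_of_nat
    by (intro tendsto_ennrealI tendsto_intros) (simp_all add: inverse_eq_divide)
  then have "?I \<le> ennreal (exp (expectation F + L\<^sup>2 * s\<^sup>2 * (1 + 0) / 2))"
    by (rule LIMSEQ_le_const) (use bound_with_slack in blast)
  then show ?thesis by simp
qed

theorem lipschitz_isotropic_normal_concentration:
  fixes F :: "real ^ 'n \<Rightarrow> real"
  assumes "s > 0" "L > 0" and lipschitz: "L-lipschitz_on UNIV F" and "t \<ge> 0"
  shows "measure (isotropic_normal s) {x. (\<integral>x. F x \<partial>isotropic_normal s) + t \<le> F x}
    \<le> exp (- t\<^sup>2 / (2 * L\<^sup>2 * s\<^sup>2))"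
proof (cases "t = 0")
  case False
  interpret prob_space "isotropic_normal s :: (real ^ 'n) measure"
    by (rule prob_space_isotropic_normal[OF \<open>s > 0\<close>])
  define m where "m = expectation F"
  define \<theta> where "\<theta> = t / (L\<^sup>2 * s\<^sup>2)"
  have "\<theta> > 0" using assms False by (simp add: \<theta>_def)
  note [measurable] = borel_measurable_lipschitz[OF lipschitz]
  have "emeasure (isotropic_normal s) {x. m + t \<le> F x}
      \<le> ennreal (exp (- \<theta> * (m + t))) * (\<integral>\<^sup>+x. ennreal (exp (\<theta> * F x)) \<partial>isotropic_normal s)"
    using Chernoff_ineq_nn_integral_ge[OF \<open>\<theta> > 0\<close>, of UNIV "isotropic_normal s" F "m + t"] by simp
  also have "\<dots> \<le> ennreal (exp (- \<theta> * (m + t))) * ennreal (exp (\<theta> * m + (\<theta> * L)\<^sup>2 * s\<^sup>2 / 2))"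
  proof (rule mult_left_mono)
    have "(\<theta> * L)-lipschitz_on UNIV (\<lambda>x. \<theta> * F x)"
      using \<open>\<theta> > 0\<close> by (intro lipschitz_on_cmult_real_nonneg lipschitz) auto
    from nn_integral_exp_lipschitz_isotropic_normal_le[OF \<open>s > 0\<close> this]
    show "(\<integral>\<^sup>+x. ennreal (exp (\<theta> * F x)) \<partial>isotropic_normal s) \<le>
        ennreal (exp (\<theta> * m + (\<theta> * L)\<^sup>2 * s\<^sup>2 / 2))"
      by (simp add: m_def)
  qed simp
  also have "\<dots> = ennreal (exp ((\<theta> * L)\<^sup>2 * s\<^sup>2 / 2 - \<theta> * t))"
    by (simp add: ennreal_mult[symmetric] mult_exp_exp algebra_simps)
  also have "(\<theta> * L)\<^sup>2 * s\<^sup>2 / 2 - \<theta> * t = - t\<^sup>2 / (2 * L\<^sup>2 * s\<^sup>2)"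
    using assms by (simp add: \<theta>_def power2_eq_square field_simps)
  finally show ?thesis by (simp add: emeasure_eq_measure m_def)
qed (simp add: prob_space.prob_le_1[OF prob_space_isotropic_normal[OF \<open>s > 0\<close>]])

subsection \<open>Projections onto closed convex cones\<close>

locale closed_convex_cone =
  fixes L :: "'a::euclidean_space set"
  assumes closed: "closed L" and convex: "convex L" and cone: "cone L" and nonempty: "L \<noteq> {}"
begin

lemma closest_point_mem: "closest_point L x \<in> L"
  by (rule closest_point_in_set[OF closed nonempty])

lemma inner_diff_closest_point_eq_0: "(x - closest_point L x) \<bullet> closest_point L x = 0"
proof -
  let ?p = "closest_point L x"
  have "(x - ?p) \<bullet> (c *\<^sub>R ?p - ?p) \<le> 0" if "c \<ge> 0" for c
    using closest_point_dot[OF convex closed mem_cone[OF cone closest_point_mem that]] .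
  from this[of 0] this[of 2] show ?thesis
    by (simp add: scaleR_2)
qed

lemma norm_closest_point_power2:
  "(norm (closest_point L x))\<^sup>2 = (norm x)\<^sup>2 - (dist x (closest_point L x))\<^sup>2"
proof -
  have "orthogonal (x - closest_point L x) (closest_point L x)"
    unfolding orthogonal_def by (rule inner_diff_closest_point_eq_0)
  from norm_add_Pythagorean[OF this] show ?thesis
    by (simp add: dist_norm)
qed

lemma norm_closest_point_le: "norm (closest_point L x) \<le> norm x"
  by (rule power2_le_imp_le) (simp_all add: norm_closest_point_power2)

lemma two_inner_diff_norm_power2_le_norm_closest_point:
  assumes "w \<in> L"
  shows "2 * (x \<bullet> w) - (norm w)\<^sup>2 \<le> (norm (closest_point L x))\<^sup>2"
proof -
  have "(dist x (closest_point L x))\<^sup>2 \<le> (dist x w)\<^sup>2"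
    using closest_point_le[OF closed assms] by (intro power_mono) auto
  also have "\<dots> = (norm x)\<^sup>2 - 2 * (x \<bullet> w) + (norm w)\<^sup>2"
    by (simp add: dist_norm power2_norm_eq_inner inner_diff_left inner_diff_right inner_commute)
  finally show ?thesis
    by (simp add: norm_closest_point_power2)
qed

lemma closest_point_scaleR:
  assumes "c > 0"
  shows "closest_point L (c *\<^sub>R x) = c *\<^sub>R closest_point L x"
proof (rule sym, rule closest_point_unique[OF convex closed])
  have dist_scaleR: "dist (c *\<^sub>R a) (c *\<^sub>R b) = c * dist a b" for a b :: 'a
    using assms by (simp add: dist_norm scaleR_diff_right[symmetric])
  show "c *\<^sub>R closest_point L x \<in> L"
    using assms by (intro mem_cone cone closest_point_mem) auto
  show "\<forall>z\<in>L. dist (c *\<^sub>R x) (c *\<^sub>R closest_point L x) \<le> dist (c *\<^sub>R x) z"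
  proof
    fix z assume "z \<in> L"
    then have "(1 / c) *\<^sub>R z \<in> L"
      using assms by (intro mem_cone cone) auto
    from closest_point_le[OF closed this]
    show "dist (c *\<^sub>R x) (c *\<^sub>R closest_point L x) \<le> dist (c *\<^sub>R x) z"
      using assms dist_scaleR[of x "(1 / c) *\<^sub>R z"] by (simp add: dist_scaleR)
  qed
qed

lemma lipschitz_norm_closest_point: "1-lipschitz_on UNIV (\<lambda>x. norm (closest_point L x))"
proof (rule lipschitz_onI)
  fix x y
  have "dist (norm (closest_point L x)) (norm (closest_point L y)) \<le>
      dist (closest_point L x) (closest_point L y)"
    by (simp add: dist_norm norm_triangle_ineq3)
  also have "\<dots> \<le> dist x y"
    by (rule closest_point_lipschitz[OF convex closed nonempty])
  finally show "dist (norm (closest_point L x)) (norm (closest_point L y)) \<le> 1 * dist x y" by simp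
qed simp

lemma borel_measurable_closest_point [measurable]: "closest_point L \<in> borel_measurable borel"
  by (intro borel_measurable_continuous_onI continuous_on_closest_point convex closed nonempty)

end

lemma integrable_norm_closest_point_power2:
  fixes L :: "(real ^ 'n) set"
  assumes "closed_convex_cone L" "s > 0"
  shows "integrable (isotropic_normal s) (\<lambda>x. (norm (closest_point L x))\<^sup>2)"
proof -
  interpret closed_convex_cone L by fact
  show ?thesis
    by (rule Bochner_Integration.integrable_bound
        [OF integrable_norm_power2_isotropic_normal[OF assms(2)]])
      (auto intro: power_mono norm_closest_point_le)
qed

lemma integral_norm_closest_point_power2:
  fixes L :: "(real ^ 'n) set"
  assumes "closed_convex_cone L" "s > 0"
  shows "(\<integral>x. (norm (closest_point L x))\<^sup>2 \<partial>isotropic_normal s) = s\<^sup>2 * statistical_dimension L"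
proof -
  interpret closed_convex_cone L by fact
  have "(\<integral>x. (norm (closest_point L x))\<^sup>2 \<partial>isotropic_normal s) =
      (\<integral>g. (norm (closest_point L (s *\<^sub>R g)))\<^sup>2 \<partial>isotropic_normal 1)"
    by (subst distr_scaleR_isotropic_normal[OF assms(2), symmetric])
      (rule integral_distr; measurable)
  also have "\<dots> = s\<^sup>2 * statistical_dimension L"
    using assms(2)
    by (simp add: closest_point_scaleR power_mult_distrib statistical_dimension_def
        isotropic_normal_def)
  finally show ?thesis .
qed

lemma statistical_dimension_nonneg: "0 \<le> statistical_dimension L"
  by (simp add: statistical_dimension_def)

lemma (in prob_space) expectation_le_sqrt_expectation_power2:
  fixes X :: "'a \<Rightarrow> real"
  assumes "integrable M X" "integrable M (\<lambda>x. (X x)\<^sup>2)"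
  shows "expectation X \<le> sqrt (expectation (\<lambda>x. (X x)\<^sup>2))"
  using variance_positive[of X] by (intro real_le_rsqrt) (simp add: variance_eq[OF assms])

lemma norm_closest_point_concentration:
  fixes L :: "(real ^ 'n) set"
  assumes "closed_convex_cone L" "s > 0" "t \<ge> 0"
  shows "measure (isotropic_normal s)
      {x. s * sqrt (statistical_dimension L) + t \<le> norm (closest_point L x)}
    \<le> exp (- t\<^sup>2 / (2 * s\<^sup>2))"
proof -
  interpret closed_convex_cone L by fact
  interpret prob_space "isotropic_normal s :: (real ^ 'n) measure"
    by (rule prob_space_isotropic_normal[OF assms(2)])
  let ?m = "expectation (\<lambda>x. norm (closest_point L x))"
  have "?m \<le> sqrt (s\<^sup>2 * statistical_dimension L)"
    unfolding integral_norm_closest_point_power2[OF assms(1,2), symmetric]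
    by (intro expectation_le_sqrt_expectation_power2 integrable_norm_closest_point_power2 assms(1,2)
        integrable_lipschitz_isotropic_normal[OF _ lipschitz_norm_closest_point])
  then have "prob {x. s * sqrt (statistical_dimension L) + t \<le> norm (closest_point L x)}
      \<le> prob {x. ?m + t \<le> norm (closest_point L x)}"
    using assms(2) by (intro finite_measure_mono) (auto simp: real_sqrt_mult)
  also have "\<dots> \<le> exp (- t\<^sup>2 / (2 * 1\<^sup>2 * s\<^sup>2))"
    by (intro lipschitz_isotropic_normal_concentration lipschitz_norm_closest_point assms(2,3)) simp
  finally show ?thesis by simp
qed

subsection \<open>Least squares over a convex set\<close>

lemma tangent_cone_eq_closure_cone_hull:
  "tangent_cone K u = closure (cone hull ((\<lambda>v. v - u) ` K))"
  unfolding tangent_cone_def cone_hull_expl by (rule arg_cong[where f=closure]) auto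

lemma diff_in_tangent_cone:
  assumes "v \<in> K"
  shows "v - u \<in> tangent_cone K u"
  unfolding tangent_cone_eq_closure_cone_hull
  by (rule subsetD[OF closure_subset]) (use assms in \<open>auto intro: hull_inc\<close>)

lemma closed_convex_cone_tangent_cone:
  assumes "convex K" "u \<in> K"
  shows "closed_convex_cone (tangent_cone K u)"
proof
  have "convex ((\<lambda>v. v - u) ` K)"
    using convex_translation[OF assms(1), of "- u"] by simp
  then show "closed (tangent_cone K u)" "convex (tangent_cone K u)" "cone (tangent_cone K u)"
    unfolding tangent_cone_eq_closure_cone_hull
    by (auto intro!: convex_closure convex_cone_hull cone_closure cone_cone_hull)
  show "tangent_cone K u \<noteq> {}"
    using diff_in_tangent_cone[OF assms(2)] by blast
qed

lemma closest_point_excess_risk: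
  fixes K :: "(real ^ 'n) set"
  assumes "closed K" "convex K" "u \<in> K"
  shows "(norm (closest_point K (m + w) - m))\<^sup>2 - (norm (u - m))\<^sup>2
    \<le> (norm (closest_point (tangent_cone K u) w))\<^sup>2"
proof -
  interpret closed_convex_cone "tangent_cone K u"
    by (rule closed_convex_cone_tangent_cone[OF assms(2,3)])
  let ?p = "closest_point K (m + w)"
  define d where "d = ?p - u"
  have "(m + w - ?p) \<bullet> (u - ?p) \<le> 0"
    using assms by (intro closest_point_dot)
  then have "(norm d)\<^sup>2 \<le> (m + w - u) \<bullet> d"
    by (simp add: d_def power2_norm_eq_inner inner_diff_left inner_diff_right inner_add_left
        inner_commute)
  moreover have "(norm (?p - m))\<^sup>2 - (norm (u - m))\<^sup>2 = (norm d)\<^sup>2 + 2 * ((u - m) \<bullet> d)"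
    by (simp add: d_def power2_norm_eq_inner inner_diff_left inner_diff_right inner_commute)
  ultimately have "(norm (?p - m))\<^sup>2 - (norm (u - m))\<^sup>2 \<le> 2 * (w \<bullet> d) - (norm d)\<^sup>2"
    by (simp add: inner_diff_left inner_add_left)
  also have "\<dots> \<le> (norm (closest_point (tangent_cone K u) w))\<^sup>2"
    unfolding d_def
    using assms by (intro two_inner_diff_norm_power2_le_norm_closest_point diff_in_tangent_cone
        closest_point_in_set) auto
  finally show ?thesis .
qed

lemma scaled_norm_power2: "(scaled_norm v)\<^sup>2 = (norm (v :: real ^ 'n))\<^sup>2 / real CARD('n)"
  by (simp add: scaled_norm_def sum_nonneg norm_vec_power2)

lemma is_least_squares_imp_eq_closest_point:
  assumes "closed K" "convex K" "is_least_squares K y m"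
  shows "m = closest_point K y"
proof (rule closest_point_unique[OF assms(2,1)])
  have minimal: "m \<in> K" "\<And>z. z \<in> K \<Longrightarrow> (scaled_norm (y - m))\<^sup>2 \<le> (scaled_norm (y - z))\<^sup>2"
    using assms(3) by (auto simp: is_least_squares_def is_arg_min_linorder)
  then show "m \<in> K" "\<forall>z\<in>K. dist y m \<le> dist y z"
    by (auto simp: scaled_norm_power2 divide_le_cancel dist_norm)
qed

locale gaussian_least_squares = prob_space M
  for M :: "'a measure" +
  fixes \<mu> u :: "real ^ 'n" and K :: "(real ^ 'n) set" and \<sigma> :: real
    and \<xi> \<mu>hat :: "'a \<Rightarrow> real ^ 'n"
  assumes closed_K: "closed K" and convex_K: "convex K" and u_in_K: "u \<in> K"
    and \<sigma>_pos: "\<sigma> > 0"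
    and noise: "distributed M lborel \<xi> (\<lambda>x. ennreal (isotropic_normal_density \<sigma> x))"
    and estimator: "\<And>\<omega>. \<omega> \<in> space M \<Longrightarrow> is_least_squares K (\<mu> + \<xi> \<omega>) (\<mu>hat \<omega>)"
begin

sublocale tangent: closed_convex_cone "tangent_cone K u"
  by (rule closed_convex_cone_tangent_cone[OF convex_K u_in_K])

abbreviation \<delta> :: real where
  "\<delta> \<equiv> statistical_dimension (tangent_cone K u)"

definition projected_noise :: "'a \<Rightarrow> real" where
  "projected_noise \<omega> = norm (closest_point (tangent_cone K u) (\<xi> \<omega>))"

lemma borel_measurable_noise [measurable]: "\<xi> \<in> borel_measurable M"
  using distributed_measurable[OF noise] by simp

lemma distr_noise: "distr M borel \<xi> = isotropic_normal \<sigma>"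
  using distributed_distr_eq_density[OF noise]
  by (simp add: isotropic_normal_def cong: distr_cong)

lemma borel_measurable_projected_noise [measurable]: "projected_noise \<in> borel_measurable M"
  unfolding projected_noise_def[abs_def] by measurable

lemma estimator_eq_closest_point: "\<omega> \<in> space M \<Longrightarrow> \<mu>hat \<omega> = closest_point K (\<mu> + \<xi> \<omega>)"
  by (rule is_least_squares_imp_eq_closest_point[OF closed_K convex_K estimator])

lemma borel_measurable_risk [measurable]:
  "(\<lambda>\<omega>. (scaled_norm (\<mu>hat \<omega> - \<mu>))\<^sup>2) \<in> borel_measurable M"
proof -
  have [measurable]: "closest_point K \<in> borel_measurable borel"
    using closed_K convex_K u_in_K
    by (intro borel_measurable_continuous_onI continuous_on_closest_point) auto
  have "(\<lambda>\<omega>. (norm (closest_point K (\<mu> + \<xi> \<omega>) - \<mu>))\<^sup>2 / real CARD('n)) \<in> borel_measurable M"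
    by measurable
  then show ?thesis
    by (rule measurable_cong[THEN iffD1, rotated])
      (simp add: scaled_norm_power2 estimator_eq_closest_point)
qed

lemma risk_le_projected_noise:
  assumes "\<omega> \<in> space M"
  shows "(scaled_norm (\<mu>hat \<omega> - \<mu>))\<^sup>2 \<le>
    (scaled_norm (u - \<mu>))\<^sup>2 + (projected_noise \<omega>)\<^sup>2 / real CARD('n)"
  using closest_point_excess_risk[OF closed_K convex_K u_in_K, of \<mu> "\<xi> \<omega>"]
  by (simp add: scaled_norm_power2 estimator_eq_closest_point[OF assms] projected_noise_def
      add_divide_distrib[symmetric] divide_right_mono)

lemma integrable_projected_noise_power2: "integrable M (\<lambda>\<omega>. (projected_noise \<omega>)\<^sup>2)"
  and expectation_projected_noise_power2: "expectation (\<lambda>\<omega>. (projected_noise \<omega>)\<^sup>2) = \<sigma>\<^sup>2 * \<delta>"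
proof -
  show "integrable M (\<lambda>\<omega>. (projected_noise \<omega>)\<^sup>2)"
    using integrable_norm_closest_point_power2[OF tangent.closed_convex_cone_axioms \<sigma>_pos]
    unfolding distr_noise[symmetric] projected_noise_def by (subst (asm) integrable_distr_eq) auto
  show "expectation (\<lambda>\<omega>. (projected_noise \<omega>)\<^sup>2) = \<sigma>\<^sup>2 * \<delta>"
    using integral_norm_closest_point_power2[OF tangent.closed_convex_cone_axioms \<sigma>_pos]
    unfolding distr_noise[symmetric] projected_noise_def by (subst (asm) integral_distr) auto
qed

lemma integrable_risk: "integrable M (\<lambda>\<omega>. (scaled_norm (\<mu>hat \<omega> - \<mu>))\<^sup>2)"
proof (rule Bochner_Integration.integrable_bound)
  show "integrable M (\<lambda>\<omega>. (scaled_norm (u - \<mu>))\<^sup>2 + (projected_noise \<omega>)\<^sup>2 / real CARD('n))"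
    by (simp add: integrable_projected_noise_power2)
qed (use risk_le_projected_noise in \<open>auto intro!: AE_I2\<close>)

lemma expectation_risk_le:
  "expectation (\<lambda>\<omega>. (scaled_norm (\<mu>hat \<omega> - \<mu>))\<^sup>2) \<le> (scaled_norm (u - \<mu>))\<^sup>2 + \<sigma>\<^sup>2 / real CARD('n) * \<delta>"
proof -
  have "expectation (\<lambda>\<omega>. (scaled_norm (\<mu>hat \<omega> - \<mu>))\<^sup>2) \<le>
      expectation (\<lambda>\<omega>. (scaled_norm (u - \<mu>))\<^sup>2 + (projected_noise \<omega>)\<^sup>2 / real CARD('n))"
    by (intro integral_mono integrable_risk risk_le_projected_noise)
      (simp_all add: integrable_projected_noise_power2)
  also have "\<dots> = (scaled_norm (u - \<mu>))\<^sup>2 + \<sigma>\<^sup>2 / real CARD('n) * \<delta>"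
    by (simp add: integrable_projected_noise_power2 expectation_projected_noise_power2 prob_space)
  finally show ?thesis .
qed

lemma prob_projected_noise_less:
  assumes "x > 0"
  shows "prob {\<omega> \<in> space M. projected_noise \<omega> < \<sigma> * (sqrt \<delta> + sqrt (2 * x))} \<ge> 1 - exp (- x)"
proof -
  let ?far = "{g. \<sigma> * sqrt \<delta> + \<sigma> * sqrt (2 * x) \<le> norm (closest_point (tangent_cone K u) g)}"
  have far_borel: "?far \<in> sets borel" by measurable
  have "prob (\<xi> -` ?far \<inter> space M) = measure (isotropic_normal \<sigma>) ?far"
    unfolding distr_noise[symmetric] using far_borel by (subst measure_distr) auto
  also have "\<dots> \<le> exp (- (\<sigma> * sqrt (2 * x))\<^sup>2 / (2 * \<sigma>\<^sup>2))"
    using \<sigma>_pos assms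
    by (intro norm_closest_point_concentration tangent.closed_convex_cone_axioms) auto
  also have "\<dots> = exp (- x)"
    using \<sigma>_pos assms by (simp add: power_mult_distrib)
  finally have "1 - exp (- x) \<le> 1 - prob (\<xi> -` ?far \<inter> space M)" by simp
  also have "\<dots> = prob (space M - \<xi> -` ?far \<inter> space M)"
    using far_borel by (intro prob_compl[symmetric] measurable_sets[OF borel_measurable_noise])
  also have "space M - \<xi> -` ?far \<inter> space M =
      {\<omega> \<in> space M. projected_noise \<omega> < \<sigma> * (sqrt \<delta> + sqrt (2 * x))}"
    by (auto simp: projected_noise_def distrib_left)
  finally show ?thesis .
qed

lemma prob_excess_risk_le:
  assumes "x > 0"
  shows "prob {\<omega> \<in> space M. (scaled_norm (\<mu>hat \<omega> - \<mu>))\<^sup>2 - (scaled_norm (u - \<mu>))\<^sup>2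
      \<le> \<sigma>\<^sup>2 / real CARD('n) * (sqrt \<delta> + sqrt (2 * x))\<^sup>2} \<ge> 1 - exp (- x)"
proof (rule order_trans[OF prob_projected_noise_less[OF assms] finite_measure_mono], safe)
  fix \<omega> assume \<omega>: "\<omega> \<in> space M" and "projected_noise \<omega> < \<sigma> * (sqrt \<delta> + sqrt (2 * x))"
  then have "(projected_noise \<omega>)\<^sup>2 \<le> \<sigma>\<^sup>2 * (sqrt \<delta> + sqrt (2 * x))\<^sup>2"
    unfolding power_mult_distrib[symmetric] by (intro power_mono) (auto simp: projected_noise_def)
  then have "(projected_noise \<omega>)\<^sup>2 / real CARD('n) \<le> \<sigma>\<^sup>2 / real CARD('n) * (sqrt \<delta> + sqrt (2 * x))\<^sup>2"
    by (simp add: divide_right_mono)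
  then show "(scaled_norm (\<mu>hat \<omega> - \<mu>))\<^sup>2 - (scaled_norm (u - \<mu>))\<^sup>2
      \<le> \<sigma>\<^sup>2 / real CARD('n) * (sqrt \<delta> + sqrt (2 * x))\<^sup>2"
    using risk_le_projected_noise[OF \<omega>] by linarith
qed measurable

end

lemma sqrt_add_sqrt_power2_le:
  assumes "0 \<le> a" "0 \<le> b"
  shows "(sqrt a + sqrt b)\<^sup>2 \<le> 2 * a + 2 * b"
  using sum_squares_bound[of "sqrt a" "sqrt b"] assms by (simp add: power2_sum)

theorem corollary2p2:
  fixes M :: "'a measure"
    and \<mu> u :: "real ^ 'n"
    and K :: "(real ^ 'n) set"
    and \<sigma> :: real
    and \<xi> y \<mu>hat :: "'a \<Rightarrow> real ^ 'n"
  assumes "prob_space M"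
    and "closed K" and "convex K" and "u \<in> K"
    and "\<sigma> > 0"
    and "distributed M lborel \<xi> (\<lambda>x. ennreal (isotropic_normal_density \<sigma> x))"
    and "y = (\<lambda>\<omega>. \<mu> + \<xi> \<omega>)"
    and "\<And>\<omega>. \<omega> \<in> space M \<Longrightarrow> is_least_squares K (y \<omega>) (\<mu>hat \<omega>)"
  shows "integrable M (\<lambda>\<omega>. (scaled_norm (\<mu>hat \<omega> - \<mu>))\<^sup>2)
    \<and> (\<integral>\<omega>. (scaled_norm (\<mu>hat \<omega> - \<mu>))\<^sup>2 \<partial>M)
        \<le> (scaled_norm (u - \<mu>))\<^sup>2
          + \<sigma>\<^sup>2 / real CARD('n) * statistical_dimension (tangent_cone K u)
    \<and> (\<forall>x>0. measure M {\<omega> \<in> space M.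
            (scaled_norm (\<mu>hat \<omega> - \<mu>))\<^sup>2 - (scaled_norm (u - \<mu>))\<^sup>2
              \<le> \<sigma>\<^sup>2 / real CARD('n) * (sqrt (statistical_dimension (tangent_cone K u)) + sqrt (2 * x))\<^sup>2
          \<and> \<sigma>\<^sup>2 / real CARD('n) * (sqrt (statistical_dimension (tangent_cone K u)) + sqrt (2 * x))\<^sup>2
              \<le> \<sigma>\<^sup>2 / real CARD('n) * (2 * statistical_dimension (tangent_cone K u) + 4 * x)}
          \<ge> 1 - exp (- x))"
proof -
  interpret gaussian_least_squares M \<mu> u K \<sigma> \<xi> \<mu>hat
    using assms by (simp add: gaussian_least_squares_def gaussian_least_squares_axioms_def)
  have "\<sigma>\<^sup>2 / real CARD('n) * (sqrt \<delta> + sqrt (2 * x))\<^sup>2 \<le> \<sigma>\<^sup>2 / real CARD('n) * (2 * \<delta> + 4 * x)"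
    if "x > 0" for x
    using sqrt_add_sqrt_power2_le[of \<delta> "2 * x"] that statistical_dimension_nonneg
    by (intro mult_left_mono) auto
  then show ?thesis
    using integrable_risk expectation_risk_le prob_excess_risk_le by simp
qed

end
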